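(* Consider the decision-dependent distributionally robust problem $$\min_{x\in\mathcal X}\; c^\top x+x^\top C x+\max_{p\in\mathcal P(x)}\ \sum_{\omega=1}^N p_\omega\, h(x,\xi_\omega).\qquad (\mathrm{DRO})$$ For $\omega\in[N]$ put $\varphi_\omega[z]=\overline p_\omega (z)_+-\underline p_\omega(-z)_+$ and $$G_\omega(x,\lambda):=\varphi_\omega\big[h(x,\xi_\omega)-\lambda^\top g(\xi_\omega)\big].$$ Then (DRO) can be reformulated as $$\min_{x,\lambda}\Big\{c^\top x+x^\top C x+\lambda^\top\vartheta(x)+\sum_{\omega\in[N]}G_\omega(x,\lambda)\;:\;x\in\mathcal X,\ \lambda\in\mathbb R^s,\ \lambda\ge 0\Big\},$$ i.e. the two problems have the same optimal value, and $x^*\in\mathcal X$ is optimal for (DRO) if and only if there is $\lambda^*\ge 0$ such that $(x^*,\lambda^* )$ is optimal for the second problem.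
   Context: Notation: $[n]=\{1,\dots,n\}$, $(a)_+=\max\{0,a\}$; vector inequalities are componentwise. Setting. $\mathcal X=\{x\in\mathbb Z^{n_1}\times\mathbb R^{n_x-n_1}: Ax\ge d,\ x\ge 0\}$ is nonempty and compact, $n_1\ge 0$. The random vector $\xi$ has finite, decision-independent support $\{\xi_\omega\}_{\omega=1}^N$. The recourse function is $$h(x,\xi_\omega)=\min_{y\in\mathcal Y(x,\xi_\omega)}\psi_0(x,y,\xi_\omega),\qquad \psi_0(x,y,\xi_\omega)=q_\omega^\top y+x^\top L_\omega y,$$ $$\mathcal Y(x,\xi_\omega)=\{y\in\mathbb R^{n_y}: D_\omega y\ge B_\omega x+b_\omega,\ y\ge 0\},$$ with data $q_\omega,L_\omega,D_\omega,B_\omega,b_\omega$ of appropriate dimensions. Ambiguity set. For $x\in\mathcal X$, $$\mathcal P(x)=\Big\{p\in\mathbb R^N,\ p\ge 0:\ \underline p_\omega\le p_\omega\le\overline p_\omega\ (\omega\in[N]),\ \sum_{\omega\in[N]}p_\omega g^i(\xi_\omega)\le\vartheta^i(x)\ (i\in[s])\Big\},$$ where $0\le\underline p_\omega\le\overline p_\omega$ are bounds on the probabilities, $g^i$ are real functions on the support, $\vartheta^i:\mathcal X\to\mathbb R$, and $g=(g^1,\dots,g^s)^\top$, $\vartheta(x)=(\vartheta^1(x),\dots,\vartheta^s(x))^\top$. To force $p$ to be a probability vector, $g^1\equiv 1,\vartheta^1\equiv 1,g^2\equiv -1,\vartheta^2\equiv -1$. Standing assumptions. $\mathcal P(x)$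 is nonempty for every $x\in\mathcal X$. For every $x\in\mathbb R^{n_x}$ and $\omega\in[N]$ the recourse problem has complete recourse (it is feasible, $\mathcal Y(x,\xi_\omega)\neq\emptyset$) and $\mathcal Y(x,\xi_\omega)$ is bounded. *)

theory Defs
  imports "HOL-Analysis.Analysis"
begin

text \<open>
  Dimensions are index types; \<open>\<le>\<close> on vectors is the componentwise order of the library.
  The integrality restrictions apply to the coordinates in an arbitrary set \<open>J\<close>, so that
  \<open>card J\<close> is the number of integer variables.
\<close>

definition first_stage_set ::
  "real^'n^'m \<Rightarrow> real^'m \<Rightarrow> 'n set \<Rightarrow> (real^'n) set" where
  "first_stage_set A d J = {x. A *v x \<ge> d \<and> x \<ge> 0 \<and> (\<forall>j\<in>J. x $ j \<in> \<int>)}"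

definition recourse_set ::
  "real^'y^'k \<Rightarrow> real^'n^'k \<Rightarrow> real^'k \<Rightarrow> real^'n \<Rightarrow> (real^'y) set" where
  "recourse_set D B b x = {y. D *v y \<ge> B *v x + b \<and> y \<ge> 0}"

definition recourse_cost ::
  "real^'y \<Rightarrow> real^'y^'n \<Rightarrow> real^'n \<Rightarrow> real^'y \<Rightarrow> real" where
  "recourse_cost q L x y = q \<bullet> y + x \<bullet> (L *v y)"

text \<open>
  The real infimum below is a minimum whenever the recourse set is nonempty and bounded; see
  \<open>recourse_value_attained\<close>.
\<close>

definition recourse_value ::
  "real^'y \<Rightarrow> real^'y^'n \<Rightarrow> real^'y^'k \<Rightarrow> real^'n^'k \<Rightarrow> real^'k \<Rightarrow> real^'n \<Rightarrow> real" where
  "recourse_value q L D B b x = (INF y\<in>recourse_set D B b x. recourse_cost q L x y)"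

text \<open>
  \<open>\<xi> \<omega>\<close> is the realization of the random vector in scenario \<open>\<omega>\<close>, and \<open>g\<close> and \<open>\<theta>\<close> collect
  the functions defining the moment constraints into vectors.
\<close>

definition ambiguity_set ::
  "real^'w \<Rightarrow> real^'w \<Rightarrow> ('w \<Rightarrow> real^'r) \<Rightarrow> (real^'r \<Rightarrow> real^'s) \<Rightarrow>
   (real^'n \<Rightarrow> real^'s) \<Rightarrow> real^'n \<Rightarrow> (real^'w) set" where
  "ambiguity_set pl pu \<xi> g \<theta> x =
     {p. p \<ge> 0 \<and> (\<forall>\<omega>. pl $ \<omega> \<le> p $ \<omega> \<and> p $ \<omega> \<le> pu $ \<omega>) \<and>
         (\<forall>i. (\<Sum>\<omega>\<in>UNIV. p $ \<omega> * g (\<xi> \<omega>) $ i) \<le> \<theta> x $ i)}"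

text \<open>
  The real supremum below is a maximum over every nonempty ambiguity set; see
  \<open>worst_case_expectation_attained\<close>.
\<close>

definition worst_case_expectation :: "(real^'w) set \<Rightarrow> ('w \<Rightarrow> real) \<Rightarrow> real" where
  "worst_case_expectation P v = (SUP p\<in>P. \<Sum>\<omega>\<in>UNIV. p $ \<omega> * v \<omega>)"

definition dro_objective ::
  "real^'n \<Rightarrow> real^'n^'n \<Rightarrow> (real^'n \<Rightarrow> (real^'w) set) \<Rightarrow> (real^'n \<Rightarrow> 'w \<Rightarrow> real) \<Rightarrow>
   real^'n \<Rightarrow> real" where
  "dro_objective c C P h x = c \<bullet> x + x \<bullet> (C *v x) + worst_case_expectation (P x) (h x)"

definition pos_part :: "real \<Rightarrow> real" where
  "pos_part a = max 0 a"

definition phi :: "real^'w \<Rightarrow> real^'w \<Rightarrow> 'w \<Rightarrow> real \<Rightarrow> real" where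
  "phi pl pu \<omega> z = pu $ \<omega> * pos_part z - pl $ \<omega> * pos_part (- z)"

definition G_term ::
  "real^'w \<Rightarrow> real^'w \<Rightarrow> ('w \<Rightarrow> real^'r) \<Rightarrow> (real^'r \<Rightarrow> real^'s) \<Rightarrow>
   (real^'n \<Rightarrow> 'w \<Rightarrow> real) \<Rightarrow> 'w \<Rightarrow> real^'n \<Rightarrow> real^'s \<Rightarrow> real" where
  "G_term pl pu \<xi> g h \<omega> x l = phi pl pu \<omega> (h x \<omega> - l \<bullet> g (\<xi> \<omega>))"

definition reformulation_objective ::
  "real^'n \<Rightarrow> real^'n^'n \<Rightarrow> real^'w \<Rightarrow> real^'w \<Rightarrow> ('w \<Rightarrow> real^'r) \<Rightarrow> (real^'r \<Rightarrow> real^'s) \<Rightarrow>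
   (real^'n \<Rightarrow> real^'s) \<Rightarrow> (real^'n \<Rightarrow> 'w \<Rightarrow> real) \<Rightarrow> (real^'n) \<times> (real^'s) \<Rightarrow> real" where
  "reformulation_objective c C pl pu \<xi> g \<theta> h = (\<lambda>(x, l).
     c \<bullet> x + x \<bullet> (C *v x) + l \<bullet> \<theta> x + (\<Sum>\<omega>\<in>UNIV. G_term pl pu \<xi> g h \<omega> x l))"

lemma recourse_value_attained:
  assumes "recourse_set D B b x \<noteq> {}" and "bounded (recourse_set D B b x)"
  shows "\<exists>y\<in>recourse_set D B b x. recourse_value q L D B b x = recourse_cost q L x y \<and>
           (\<forall>z\<in>recourse_set D B b x. recourse_cost q L x y \<le> recourse_cost q L x z)"
proof -
  let ?Y = "recourse_set D B b x"
  have "closed ?Y"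
    unfolding recourse_set_def less_eq_vec_def Collect_conj_eq
    by (intro closed_Int closed_Collect_all closed_Collect_le continuous_intros
        linear_continuous_on_compose[OF _ matrix_vector_mul_linear])
  with assms have "compact ?Y" by (simp add: compact_eq_bounded_closed)
  moreover have "continuous_on ?Y (recourse_cost q L x)"
    unfolding recourse_cost_def
    by (intro continuous_intros linear_continuous_on_compose[OF _ matrix_vector_mul_linear])
  ultimately obtain y where y: "y \<in> ?Y"
    and le: "\<forall>z\<in>?Y. recourse_cost q L x y \<le> recourse_cost q L x z"
    using continuous_attains_inf assms(1) by blast
  have "recourse_value q L D B b x = recourse_cost q L x y"
    unfolding recourse_value_def
    by (rule cInf_eq_minimum) (use y le in auto)
  with y le show ?thesis by blast
qed

lemma worst_case_expectation_attained:
  assumes "ambiguity_set pl pu \<xi> g \<theta> x \<noteq> {}"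
  shows "\<exists>p\<in>ambiguity_set pl pu \<xi> g \<theta> x.
           worst_case_expectation (ambiguity_set pl pu \<xi> g \<theta> x) v = (\<Sum>\<omega>\<in>UNIV. p $ \<omega> * v \<omega>) \<and>
           (\<forall>p'\<in>ambiguity_set pl pu \<xi> g \<theta> x.
              (\<Sum>\<omega>\<in>UNIV. p' $ \<omega> * v \<omega>) \<le> (\<Sum>\<omega>\<in>UNIV. p $ \<omega> * v \<omega>))"
proof -
  let ?P = "ambiguity_set pl pu \<xi> g \<theta> x"
  have "closed ?P"
    unfolding ambiguity_set_def less_eq_vec_def Collect_conj_eq
    by (intro closed_Int closed_Collect_all closed_Collect_conj closed_Collect_le continuous_intros)
  moreover have "?P \<subseteq> cbox pl pu"
    by (auto simp: ambiguity_set_def mem_box_cart)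
  ultimately have "compact ?P"
    using bounded_cbox bounded_subset compact_eq_bounded_closed by blast
  moreover have "continuous_on ?P (\<lambda>p. \<Sum>\<omega>\<in>UNIV. p $ \<omega> * v \<omega>)"
    by (intro continuous_intros)
  ultimately obtain p where p: "p \<in> ?P"
    and le: "\<forall>p'\<in>?P. (\<Sum>\<omega>\<in>UNIV. p' $ \<omega> * v \<omega>) \<le> (\<Sum>\<omega>\<in>UNIV. p $ \<omega> * v \<omega>)"
    using continuous_attains_sup[of ?P "\<lambda>p. \<Sum>\<omega>\<in>UNIV. p $ \<omega> * v \<omega>"] assms by blast
  have "worst_case_expectation ?P v = (\<Sum>\<omega>\<in>UNIV. p $ \<omega> * v \<omega>)"
    unfolding worst_case_expectation_def
    by (rule cSup_eq_maximum) (use p le in auto)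
  with p le show ?thesis by blast
qed

end

theory Submission
  imports Defs
begin

text \<open>
  Fix a first-stage decision \<open>x\<close> and write \<open>v \<omega>\<close> for the recourse values. The worst-case
  expectation is the linear program that maximizes \<open>\<Sum>\<omega>. p \<omega> * v \<omega>\<close> over the box \<open>pl \<le> p \<le> pu\<close>
  subject to the moment constraints. Only the moment constraints are dualized, with multipliers
  \<open>l \<ge> 0\<close>; the box is kept. The Lagrangian \<open>l \<bullet> \<theta> + (\<Sum>\<omega>. p \<omega> * (v \<omega> - l \<bullet> g \<omega>))\<close> then separates
  over the scenarios, and its maximum over the box puts \<open>pu \<omega>\<close> on the scenarios with nonnegative
  bracket and \<open>pl \<omega>\<close> on the others. This is what \<open>phi\<close> computes (\<open>phi_sum_eq_box_maximum\<close>,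
  \<open>phi_sum_ge\<close>), so the objective of the reformulation at \<open>(x, l)\<close> is the first-stage
  cost plus the dual function.

  Weak duality makes the dual function an upper bound for the worst-case expectation for every
  \<open>l \<ge> 0\<close>. Equality is attained by some \<open>l\<close>, although the ambiguity set may have empty interior
  (the moment constraints even contain the equation that fixes the total mass), because everything
  is polyhedral: the lemma \<open>polytope_lp_multiplier\<close> gets the multiplier by separating a point from
  a finitely generated cone, and such a cone is always closed.

  Hence \<open>f x\<close> is the minimum of \<open>F (x, l)\<close> over \<open>l \<ge> 0\<close>, and it is attained. For such a partial
  minimization the equality of the optimal values and the correspondence of the minimizers are
  order-theoretic facts (\<open>INF_partial_minimization\<close>, \<open>is_arg_min_partial_minimization\<close>).
\<close>

section \<open>Multipliers for linear programs over polytopes\<close>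

text \<open>
  Farkas' lemma. A finitely generated cone is closed, so a point outside it is strictly separated
  from it, and a linear functional that is bounded below on a cone is nonnegative there.
\<close>

lemma finitely_generated_cone_separation:
  fixes T :: "'a::euclidean_space set"
  assumes "finite T" and "z \<notin> convex_cone hull T"
  obtains n where "n \<bullet> z < 0" and "\<And>t. t \<in> T \<Longrightarrow> 0 \<le> n \<bullet> t"
proof -
  let ?K = "convex_cone hull T"
  have "closed ?K"
    using assms(1) by (rule closed_convex_cone_hull)
  then obtain n \<beta> where z: "n \<bullet> z < \<beta>" and K: "\<And>y. y \<in> ?K \<Longrightarrow> \<beta> < n \<bullet> y"
    using separating_hyperplane_closed_point[OF convex_convex_cone_hull _ assms(2)] by blast
  have \<beta>: "\<beta> < 0"
    using K[OF convex_cone_hull_contains_0] by simp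
  have "0 \<le> n \<bullet> t" if "t \<in> T" for t
  proof (rule ccontr)
    assume "\<not> 0 \<le> n \<bullet> t"
    then have neg: "n \<bullet> t < 0" by simp
    \<comment> \<open>The multiple of \<open>t\<close> on which the functional takes the value \<open>\<beta>\<close> lies in the cone.\<close>
    have "(\<beta> / (n \<bullet> t)) *\<^sub>R t \<in> ?K"
      using that neg \<beta>
      by (intro convex_cone_hull_mul hull_inc) (auto simp: divide_nonpos_neg)
    from K[OF this] neg show False by simp
  qed
  moreover have "n \<bullet> z < 0" using z \<beta> by simp
  ultimately show thesis using that by blast
qed

text \<open>
  Polyhedrality replaces a constraint qualification here. In the space of pairs (constraint excess,
  objective excess) take the cone generated by the images of the vertices of \<open>Q\<close> and by the axes
  along which the constraints can be relaxed. The point \<open>(0, 1)\<close> lies outside: a representation of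
  it would rescale to a feasible point of \<open>Q\<close> with objective value above \<open>M\<close>.
  A separating functional, normalized in the objective coordinate, is the multiplier.
\<close>

lemma polytope_lp_multiplier:
  fixes Q :: "'a::euclidean_space set" and a :: "'a \<Rightarrow> real^'s" and w :: "'a \<Rightarrow> real"
  assumes "polytope Q" and "linear a" and "linear w"
    and opt: "\<And>p. p \<in> Q \<Longrightarrow> a p \<le> r \<Longrightarrow> w p \<le> M"
  obtains l where "l \<ge> 0" and "\<And>p. p \<in> Q \<Longrightarrow> w p + l \<bullet> (r - a p) \<le> M"
proof -
  obtain V where V: "finite V" "Q = convex hull V"
    using assms(1) by (auto simp: polytope_def)
  define \<phi> where "\<phi> p = (a p, w p)" for p
  define shift where "shift y = - (r, M) + y" for y
  define E where "E = range (\<lambda>i::'s. (axis i (1::real), 0::real))"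
  define T where "T = shift ` \<phi> ` V \<union> E"
  have lin: "linear \<phi>"
    unfolding \<phi>_def using assms(2,3)
    by (auto intro!: linearI simp: linear_add linear_scale)
  have fin: "finite T"
    using V(1) by (simp add: T_def E_def)
  have cone_V: "u \<in> insert 0 {s *\<^sub>R shift (\<phi> p) | s p. 0 \<le> s \<and> p \<in> Q}"
    if "u \<in> convex_cone hull (shift ` \<phi> ` V)" for u
  proof -
    have "convex hull (shift ` \<phi> ` V) = shift ` \<phi> ` Q"
      unfolding shift_def V(2)
      by (simp only: convex_hull_translation convex_hull_linear_image[OF lin])
    with that show ?thesis
      unfolding convex_cone_hull_convex_hull by auto
  qed
  have cone_E: "0 \<le> fst u \<and> snd u = 0" if "u \<in> convex_cone hull E" for u
  proof -
    have "convex_cone hull E \<subseteq> {u. 0 \<le> fst u \<and> snd u = 0}"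
      by (rule hull_minimal) (auto simp: E_def convex_cone_iff less_eq_vec_def axis_def)
    with that show ?thesis by blast
  qed
  have "(0, 1) \<notin> convex_cone hull T"
  proof
    assume "(0, 1) \<in> convex_cone hull T"
    then obtain u e where u: "u \<in> convex_cone hull (shift ` \<phi> ` V)"
      and e: "e \<in> convex_cone hull E" and sum: "(0, 1) = u + e"
      unfolding T_def convex_cone_hull_Un by auto
    have fst_u: "fst u \<le> 0" and snd_u: "snd u = 1"
    proof -
      have "u = (0, 1) - e" using sum by simp
      then show "fst u \<le> 0" "snd u = 1"
        using cone_E[OF e] by (simp_all add: less_eq_vec_def)
    qed
    then obtain s p where s: "0 \<le> s" and p: "p \<in> Q" and us: "u = s *\<^sub>R shift (\<phi> p)"
      using cone_V[OF u] by auto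
    have a_le: "s *\<^sub>R (a p - r) \<le> 0" and w_eq: "s * (w p - M) = 1"
      using fst_u snd_u unfolding us shift_def \<phi>_def by (auto simp: algebra_simps)
    with s have "0 < s" by (cases "s = 0") auto
    have "a p \<le> r"
      using a_le \<open>0 < s\<close> by (auto simp: less_eq_vec_def mult_le_0_iff)
    then have "w p \<le> M" by (rule opt[OF p])
    with \<open>0 < s\<close> have "s * (w p - M) \<le> 0" by (simp add: mult_le_0_iff)
    with w_eq show False by simp
  qed
  then obtain n where n1: "n \<bullet> (0, 1) < 0" and nT: "\<And>t. t \<in> T \<Longrightarrow> 0 \<le> n \<bullet> t"
    using finitely_generated_cone_separation[OF fin] by metis
  define \<tau> where "\<tau> = - snd n"
  define l where "l = (1 / \<tau>) *\<^sub>R fst n"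
  have \<tau>: "0 < \<tau>" and n: "n = (\<tau> *\<^sub>R l, - \<tau>)"
    using n1 by (auto simp: \<tau>_def l_def inner_prod_def prod_eq_iff)
  have "0 \<le> l $ i" for i
  proof -
    have "0 \<le> n \<bullet> (axis i 1, 0)"
      by (rule nT) (auto simp: T_def E_def)
    then show ?thesis
      using \<tau> by (simp add: n inner_axis zero_le_mult_iff)
  qed
  then have "l \<ge> 0" by (simp add: less_eq_vec_def)
  moreover have "w p + l \<bullet> (r - a p) \<le> M" if "p \<in> Q" for p
  proof -
    have "w p - l \<bullet> a p \<le> M - l \<bullet> r" if "p \<in> V" for p
    proof -
      have "0 \<le> n \<bullet> shift (\<phi> p)"
        by (rule nT) (use that in \<open>auto simp: T_def\<close>)
      also have "\<dots> = \<tau> * (l \<bullet> (a p - r) - (w p - M))"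
        by (simp add: n shift_def \<phi>_def inner_diff_right algebra_simps)
      finally show ?thesis
        using \<tau> by (simp add: zero_le_mult_iff inner_diff_right)
    qed
    then have "V \<subseteq> {p. w p - l \<bullet> a p \<le> M - l \<bullet> r}" by blast
    moreover have "convex {p. w p - l \<bullet> a p \<le> M - l \<bullet> r}"
    proof -
      have "linear (\<lambda>p. w p - l \<bullet> a p)"
        using assms(2,3)
        by (auto intro!: linearI simp: linear_add linear_scale inner_add_right algebra_simps)
      then have "convex ((\<lambda>p. w p - l \<bullet> a p) -` {.. M - l \<bullet> r})"
        by (rule convex_linear_vimage) simp
      then show ?thesis by (simp add: vimage_def)
    qed
    ultimately have "Q \<subseteq> {p. w p - l \<bullet> a p \<le> M - l \<bullet> r}"
      unfolding V(2) by (rule hull_minimal)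
    with that show ?thesis by (auto simp: inner_diff_right)
  qed
  ultimately show thesis using that by blast
qed

section \<open>Duality for the worst-case expectation\<close>

lemma phi_ge:
  assumes "pl $ \<omega> \<le> t" and "t \<le> pu $ \<omega>"
  shows "t * z \<le> phi pl pu \<omega> z"
proof (cases "0 \<le> z")
  case True
  with assms show ?thesis by (simp add: phi_def pos_part_def mult_right_mono)
next
  case False
  with assms show ?thesis by (simp add: phi_def pos_part_def mult_right_mono_neg)
qed

lemma phi_sum_ge:
  assumes "p \<in> cbox pl pu"
  shows "(\<Sum>\<omega>\<in>UNIV. p $ \<omega> * z \<omega>) \<le> (\<Sum>\<omega>\<in>UNIV. phi pl pu \<omega> (z \<omega>))"
  using assms by (intro sum_mono phi_ge) (auto simp: mem_box_cart)

lemma phi_sum_eq_box_maximum: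
  assumes "pl \<le> pu"
  obtains p where "p \<in> cbox pl pu"
    and "(\<Sum>\<omega>\<in>UNIV. p $ \<omega> * z \<omega>) = (\<Sum>\<omega>\<in>UNIV. phi pl pu \<omega> (z \<omega>))"
proof -
  define p where "p = (\<chi> \<omega>. if 0 \<le> z \<omega> then pu $ \<omega> else pl $ \<omega>)"
  have "p \<in> cbox pl pu"
    using assms by (auto simp: p_def mem_box_cart less_eq_vec_def)
  moreover have "(\<Sum>\<omega>\<in>UNIV. p $ \<omega> * z \<omega>) = (\<Sum>\<omega>\<in>UNIV. phi pl pu \<omega> (z \<omega>))"
    by (intro sum.cong) (auto simp: p_def phi_def pos_part_def)
  ultimately show thesis by (rule that)
qed

text \<open>
  Exchanging the sums over moments and scenarios shows that the Lagrangian separates over the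
  scenarios.
\<close>

lemma lagrangian_rearrange:
  fixes p :: "real^'w" and k :: "'w \<Rightarrow> real^'s"
  shows "(\<Sum>\<omega>\<in>UNIV. p $ \<omega> * v \<omega>) + l \<bullet> (r - (\<chi> i. \<Sum>\<omega>\<in>UNIV. p $ \<omega> * k \<omega> $ i)) =
    l \<bullet> r + (\<Sum>\<omega>\<in>UNIV. p $ \<omega> * (v \<omega> - l \<bullet> k \<omega>))"
proof -
  have "(\<chi> i. \<Sum>\<omega>\<in>UNIV. p $ \<omega> * k \<omega> $ i) = (\<Sum>\<omega>\<in>UNIV. p $ \<omega> *\<^sub>R k \<omega>)"
    by (simp add: vec_eq_iff)
  then show ?thesis
    by (simp add: inner_diff_right inner_sum_right right_diff_distrib sum_subtractf)
qed

lemma ambiguity_set_iff: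
  assumes "0 \<le> pl"
  shows "p \<in> ambiguity_set pl pu \<xi> g \<theta> x \<longleftrightarrow>
    p \<in> cbox pl pu \<and> (\<chi> i. \<Sum>\<omega>\<in>UNIV. p $ \<omega> * g (\<xi> \<omega>) $ i) \<le> \<theta> x"
  using assms unfolding ambiguity_set_def
  by (auto simp: mem_box_cart less_eq_vec_def intro: order_trans)

lemma worst_case_expectation_weak_duality:
  assumes "0 \<le> pl" and "ambiguity_set pl pu \<xi> g \<theta> x \<noteq> {}" and "0 \<le> l"
  shows "worst_case_expectation (ambiguity_set pl pu \<xi> g \<theta> x) v
    \<le> l \<bullet> \<theta> x + (\<Sum>\<omega>\<in>UNIV. phi pl pu \<omega> (v \<omega> - l \<bullet> g (\<xi> \<omega>)))"
proof -
  obtain p where p: "p \<in> ambiguity_set pl pu \<xi> g \<theta> x"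
    and eq: "worst_case_expectation (ambiguity_set pl pu \<xi> g \<theta> x) v = (\<Sum>\<omega>\<in>UNIV. p $ \<omega> * v \<omega>)"
    using worst_case_expectation_attained[OF assms(2)] by blast
  let ?a = "\<chi> i. \<Sum>\<omega>\<in>UNIV. p $ \<omega> * g (\<xi> \<omega>) $ i"
  have box: "p \<in> cbox pl pu" and moments: "?a \<le> \<theta> x"
    using p by (simp_all add: ambiguity_set_iff[OF assms(1)])
  have "0 \<le> l \<bullet> (\<theta> x - ?a)"
    using assms(3) moments unfolding inner_vec_def
    by (intro sum_nonneg) (simp add: less_eq_vec_def)
  then have "(\<Sum>\<omega>\<in>UNIV. p $ \<omega> * v \<omega>) \<le> (\<Sum>\<omega>\<in>UNIV. p $ \<omega> * v \<omega>) + l \<bullet> (\<theta> x - ?a)"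
    by simp
  also have "\<dots> = l \<bullet> \<theta> x + (\<Sum>\<omega>\<in>UNIV. p $ \<omega> * (v \<omega> - l \<bullet> g (\<xi> \<omega>)))"
    by (rule lagrangian_rearrange)
  also have "\<dots> \<le> l \<bullet> \<theta> x + (\<Sum>\<omega>\<in>UNIV. phi pl pu \<omega> (v \<omega> - l \<bullet> g (\<xi> \<omega>)))"
    using phi_sum_ge[OF box] by simp
  finally show ?thesis by (simp add: eq)
qed

text \<open>
  A multiplier of the linear program bounds the Lagrangian on the whole box, in particular at the
  point of the box where the Lagrangian equals the dual function.
\<close>

lemma worst_case_expectation_strong_duality:
  assumes "0 \<le> pl" and "pl \<le> pu" and "ambiguity_set pl pu \<xi> g \<theta> x \<noteq> {}"
  obtains l where "0 \<le> l"
    and "worst_case_expectation (ambiguity_set pl pu \<xi> g \<theta> x) v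
      = l \<bullet> \<theta> x + (\<Sum>\<omega>\<in>UNIV. phi pl pu \<omega> (v \<omega> - l \<bullet> g (\<xi> \<omega>)))"
proof -
  let ?M = "worst_case_expectation (ambiguity_set pl pu \<xi> g \<theta> x) v"
  let ?a = "\<lambda>p. \<chi> i. \<Sum>\<omega>\<in>UNIV. p $ \<omega> * g (\<xi> \<omega>) $ i"
  let ?w = "\<lambda>p. \<Sum>\<omega>\<in>UNIV. p $ \<omega> * v \<omega>"
  have lin_a: "linear ?a"
    by (auto intro!: linearI simp: vec_eq_iff distrib_right sum.distrib sum_distrib_left mult.assoc)
  have lin_w: "linear ?w"
    by (auto intro!: linearI simp: distrib_right sum.distrib sum_distrib_left mult.assoc)
  have opt: "?w p \<le> ?M" if "p \<in> cbox pl pu" "?a p \<le> \<theta> x" for p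
    using worst_case_expectation_attained[OF assms(3), of v] that
    by (auto simp: ambiguity_set_iff[OF assms(1)])
  obtain l where l: "0 \<le> l" and le: "\<And>p. p \<in> cbox pl pu \<Longrightarrow> ?w p + l \<bullet> (\<theta> x - ?a p) \<le> ?M"
    by (rule polytope_lp_multiplier[of "cbox pl pu" ?a ?w "\<theta> x" ?M,
          OF polytope_interval lin_a lin_w opt]) (assumption | rule that)+
  obtain p where box: "p \<in> cbox pl pu"
    and p: "(\<Sum>\<omega>\<in>UNIV. p $ \<omega> * (v \<omega> - l \<bullet> g (\<xi> \<omega>)))
      = (\<Sum>\<omega>\<in>UNIV. phi pl pu \<omega> (v \<omega> - l \<bullet> g (\<xi> \<omega>)))"
    by (rule phi_sum_eq_box_maximum[OF assms(2)]) (rule that)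
  have "l \<bullet> \<theta> x + (\<Sum>\<omega>\<in>UNIV. phi pl pu \<omega> (v \<omega> - l \<bullet> g (\<xi> \<omega>))) \<le> ?M"
    using le[OF box] unfolding lagrangian_rearrange p .
  with worst_case_expectation_weak_duality[OF assms(1,3) l, of v] l show thesis
    by (intro that) auto
qed

section \<open>Partial minimization\<close>

lemma INF_partial_minimization:
  fixes F :: "'a \<times> 'b \<Rightarrow> 'c::complete_lattice"
  assumes lower: "\<And>x l. x \<in> X \<Longrightarrow> l \<in> Y \<Longrightarrow> f x \<le> F (x, l)"
    and attained: "\<And>x. x \<in> X \<Longrightarrow> \<exists>l\<in>Y. F (x, l) = f x"
  shows "(INF x\<in>X. f x) = (INF z\<in>X \<times> Y. F z)"
proof (rule antisym)
  show "(INF x\<in>X. f x) \<le> (INF z\<in>X \<times> Y. F z)"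
    by (rule INF_mono) (use lower in auto)
  show "(INF z\<in>X \<times> Y. F z) \<le> (INF x\<in>X. f x)"
    by (rule INF_mono) (use attained in \<open>force intro: order_eq_refl\<close>)
qed

lemma is_arg_min_partial_minimization:
  fixes F :: "'a \<times> 'b \<Rightarrow> 'c::linorder"
  assumes lower: "\<And>x l. x \<in> X \<Longrightarrow> l \<in> Y \<Longrightarrow> f x \<le> F (x, l)"
    and attained: "\<And>x. x \<in> X \<Longrightarrow> \<exists>l\<in>Y. F (x, l) = f x"
  shows "is_arg_min f (\<lambda>x. x \<in> X) x \<longleftrightarrow> (\<exists>l\<in>Y. is_arg_min F (\<lambda>z. z \<in> X \<times> Y) (x, l))"
proof
  assume min: "is_arg_min f (\<lambda>x. x \<in> X) x"
  then have x: "x \<in> X" by (simp add: is_arg_min_def)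
  then obtain l where l: "l \<in> Y" "F (x, l) = f x" using attained by blast
  have "F (x, l) \<le> F (x', l')" if "x' \<in> X" "l' \<in> Y" for x' l'
    using min lower[OF that] that(1) l(2) by (auto simp: is_arg_min_linorder intro: order_trans)
  with x l(1) have "is_arg_min F (\<lambda>z. z \<in> X \<times> Y) (x, l)"
    by (auto simp: is_arg_min_linorder)
  with l(1) show "\<exists>l\<in>Y. is_arg_min F (\<lambda>z. z \<in> X \<times> Y) (x, l)" by blast
next
  assume "\<exists>l\<in>Y. is_arg_min F (\<lambda>z. z \<in> X \<times> Y) (x, l)"
  then obtain l where l: "l \<in> Y" and min: "is_arg_min F (\<lambda>z. z \<in> X \<times> Y) (x, l)" by blast
  then have x: "x \<in> X" by (simp add: is_arg_min_def)
  have "f x \<le> f x'" if x': "x' \<in> X" for x'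
  proof -
    obtain l' where l': "l' \<in> Y" "F (x', l') = f x'" using attained[OF x'] by blast
    have "f x \<le> F (x, l)" using x l by (rule lower)
    also have "\<dots> \<le> F (x', l')" using min x' l'(1) by (simp add: is_arg_min_linorder)
    finally show ?thesis by (simp add: l'(2))
  qed
  with x show "is_arg_min f (\<lambda>x. x \<in> X) x" by (simp add: is_arg_min_linorder)
qed

section \<open>The reformulation\<close>

theorem theorem1:
  fixes A :: "real^'n^'m" and d :: "real^'m" and J :: "'n set"
    and c :: "real^'n" and C :: "real^'n^'n"
    and q :: "'w::finite \<Rightarrow> real^'y" and L :: "'w \<Rightarrow> real^'y^'n"
    and D :: "'w \<Rightarrow> real^'y^'k" and B :: "'w \<Rightarrow> real^'n^'k" and b :: "'w \<Rightarrow> real^'k"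
    and \<xi> :: "'w \<Rightarrow> real^'r" and pl pu :: "real^'w"
    and g :: "real^'r \<Rightarrow> real^'s" and \<theta> :: "real^'n \<Rightarrow> real^'s" and i1 i2 :: 's
  defines "X \<equiv> first_stage_set A d J"
    and "h \<equiv> \<lambda>x \<omega>. recourse_value (q \<omega>) (L \<omega>) (D \<omega>) (B \<omega>) (b \<omega>) x"
    and "P \<equiv> ambiguity_set pl pu \<xi> g \<theta>"
  defines "f \<equiv> dro_objective c C P h"
    and "F \<equiv> reformulation_objective c C pl pu \<xi> g \<theta> h"
    and "S \<equiv> X \<times> {l :: real^'s. l \<ge> 0}"
  assumes X: "X \<noteq> {}" "compact X"
    and bounds: "0 \<le> pl" "pl \<le> pu"
    and total_mass_le: "\<And>\<omega>. g (\<xi> \<omega>) $ i1 = 1" "\<And>x. x \<in> X \<Longrightarrow> \<theta> x $ i1 = 1"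
    and total_mass_ge: "\<And>\<omega>. g (\<xi> \<omega>) $ i2 = -1" "\<And>x. x \<in> X \<Longrightarrow> \<theta> x $ i2 = -1"
    and P_nonempty: "\<And>x. x \<in> X \<Longrightarrow> P x \<noteq> {}"
    and complete_recourse: "\<And>x \<omega>. recourse_set (D \<omega>) (B \<omega>) (b \<omega>) x \<noteq> {}"
    and recourse_bounded: "\<And>x \<omega>. bounded (recourse_set (D \<omega>) (B \<omega>) (b \<omega>) x)"
  shows "(INF x\<in>X. ereal (f x)) = (INF z\<in>S. ereal (F z)) \<and>
         (\<forall>x\<in>X. is_arg_min f (\<lambda>x'. x' \<in> X) x \<longleftrightarrow>
            (\<exists>l\<ge>0. is_arg_min F (\<lambda>z. z \<in> S) (x, l)))"
proof -
  have lower: "f x \<le> F (x, l)" if "x \<in> X" "l \<in> {l. l \<ge> 0}" for x l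
    using worst_case_expectation_weak_duality[OF bounds(1), of pu \<xi> g \<theta> x l "h x"]
      P_nonempty[OF that(1)] that(2)
    by (simp add: f_def F_def dro_objective_def reformulation_objective_def G_term_def P_def)
  have attained: "\<exists>l\<in>{l. l \<ge> 0}. F (x, l) = f x" if x: "x \<in> X" for x
  proof -
    obtain l where "0 \<le> l" and "worst_case_expectation (P x) (h x)
        = l \<bullet> \<theta> x + (\<Sum>\<omega>\<in>UNIV. phi pl pu \<omega> (h x \<omega> - l \<bullet> g (\<xi> \<omega>)))"
      using worst_case_expectation_strong_duality[OF bounds P_nonempty[OF x, unfolded P_def]]
      unfolding P_def by blast
    then show ?thesis
      by (auto simp: f_def F_def dro_objective_def reformulation_objective_def G_term_def)
  qed
  have "(INF x\<in>X. ereal (f x)) = (INF z\<in>S. ereal (F z))"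
    unfolding S_def by (rule INF_partial_minimization) (use lower attained in auto)
  moreover have "is_arg_min f (\<lambda>x'. x' \<in> X) x \<longleftrightarrow> (\<exists>l\<ge>0. is_arg_min F (\<lambda>z. z \<in> S) (x, l))" for x
    using is_arg_min_partial_minimization[of X "{l. l \<ge> 0}" f F x, OF lower attained]
    unfolding S_def by simp
  ultimately show ?thesis by blast
qed

end
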